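(* Let $q\ge 2$ and $n\ge 1$ be integers. For any $\epsilon\in(0,\tfrac12)$, \[ m_q(n,2)\le \max\left\{\sum_{3\lceil \frac{1-\epsilon}{2}n\rceil-n-3\,\le\, i\,\le\, \lceil\frac{1-\epsilon}{2}n\rceil-1}\binom{n}{i}+1,\ \left(1-\frac{1}{\binom{n}{\lfloor\epsilon n\rfloor}}\right)\binom{n}{\lfloor\frac{n-1}{2}\rfloor}+2\right\}. \]
   Context: Let $Q=\{0,1,\dots,q-1\}$. For a nonempty set $X=\{\mathbf c^1,\dots,\mathbf c^s\}\subseteq Q^n$, a position $i\in[n]$ is undetectable for $X$ if $c^1_i=\dots=c^s_i$; let $U(X)$ be the set of undetectable positions, and define $\mathrm{wdesc}(X)=\{\mathbf y\in Q^n: y_i=c^1_i \text{ for all } i\in U(X)\}$. For an integer $t\ge2$, a code $\mathcal C\subseteq Q^n$ is a wide-sense $t$-frameproof code if $\mathrm{wdesc}(X)\cap\mathcal C=X$ for every nonempty $X\subseteq\mathcal C$ with $|X|\le t$. $m_q(n,t)$ denotes the maximum size of a wide-sense $t$-frameproof code in $Q^n$. Binomial coefficients $\binom{n}{i}$ with $i<0$ are $0$. *)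

theory Defs
  imports Complex_Main "HOL-Library.FuncSet"
begin

definition words :: "nat \<Rightarrow> nat \<Rightarrow> (nat \<Rightarrow> nat) set" where
  "words q n = {1..n} \<rightarrow>\<^sub>E {0..<q}"

definition undetectable :: "nat \<Rightarrow> (nat \<Rightarrow> nat) set \<Rightarrow> nat set" where
  "undetectable n X = {i \<in> {1..n}. \<forall>c\<in>X. \<forall>c'\<in>X. c i = c' i}"

text \<open>On undetectable positions all members of \<open>X\<close> agree, so for nonempty \<open>X\<close> comparing \<open>y\<close>
  with every member is the same as comparing it with one fixed member.\<close>

definition wdesc :: "nat \<Rightarrow> nat \<Rightarrow> (nat \<Rightarrow> nat) set \<Rightarrow> (nat \<Rightarrow> nat) set" where
  "wdesc q n X = {y \<in> words q n. \<forall>i \<in> undetectable n X. \<forall>c\<in>X. y i = c i}"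

definition wide_sense_frameproof :: "nat \<Rightarrow> nat \<Rightarrow> nat \<Rightarrow> (nat \<Rightarrow> nat) set \<Rightarrow> bool" where
  "wide_sense_frameproof q n t C \<longleftrightarrow>
     C \<subseteq> words q n \<and>
     (\<forall>X. X \<subseteq> C \<and> X \<noteq> {} \<and> card X \<le> t \<longrightarrow> wdesc q n X \<inter> C = X)"

definition max_frameproof :: "nat \<Rightarrow> nat \<Rightarrow> nat \<Rightarrow> nat" where
  "max_frameproof q n t = Max {card C | C. wide_sense_frameproof q n t C}"

definition int_binomial :: "nat \<Rightarrow> int \<Rightarrow> nat" where
  "int_binomial n i = (if i < 0 then 0 else n choose nat i)"

lemma finite_words: "finite (words q n)"
  unfolding words_def by (intro finite_PiE) auto

text \<open>The maximum is taken over a finite nonempty set, and \<open>card\<close> is only applied to finite sets.\<close>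

lemma finite_frameproof: "wide_sense_frameproof q n t C \<Longrightarrow> finite C"
  unfolding wide_sense_frameproof_def by (auto intro: finite_subset[OF _ finite_words])

lemma finite_frameproof_sizes: "finite {card C | C. wide_sense_frameproof q n t C}"
proof -
  have "{card C | C. wide_sense_frameproof q n t C} \<subseteq> card ` Pow (words q n)"
    unfolding wide_sense_frameproof_def by blast
  moreover have "finite (card ` Pow (words q n))"
    by (simp add: finite_words)
  ultimately show ?thesis
    by (rule finite_subset)
qed

lemma frameproof_sizes_nonempty: "{card C | C. wide_sense_frameproof q n t C} \<noteq> {}"
proof -
  have "wide_sense_frameproof q n t {}"
    unfolding wide_sense_frameproof_def by auto
  then show ?thesis by blast
qed

end

theory Submission
  imports Defs "HOL-Combinatorics.Permutations"
begin

text \<open>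
  Fix a codeword \<open>x\<close>. The sets of positions on which \<open>x\<close> agrees with the other codewords form an
  antichain no two members of which cover all positions, so by Milner's bound there are at most
  \<open>M = n choose ((n - 1) div 2)\<close> of them. This suffices if \<open>k = \<lceil>(1 - \<epsilon>) n / 2\<rceil>\<close> exceeds
  \<open>(n - 1) div 2\<close>, because then \<open>M\<close> is the last summand of the first bound. Otherwise put
  \<open>s = \<lfloor>\<epsilon> n\<rfloor>\<close>. If two codewords agree in at most \<open>s\<close> positions, this one agreement set takes up a
  fraction of at least \<open>1 / (n choose s)\<close> in the LYM-type inequality behind Milner's bound. If not,
  agreement sets of size at least \<open>k\<close> meet pairwise; then they occupy at most half of each cyclic
  order, while all others have fewer than \<open>(n - 1) div 2\<close> elements, and Katona's averaging
  over cyclic orders saves a fraction of at least \<open>1 / n\<close>.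
\<close>

section \<open>Arcs on a cycle\<close>

lemma mod_add_right_cancel_nat:
  fixes a b c n :: nat
  assumes "(a + c) mod n = (b + c) mod n"
  shows "a mod n = b mod n"
proof -
  have "(int a + int c) mod int n = (int b + int c) mod int n"
    using assms by (metis of_nat_add of_nat_mod)
  then have "int a mod int n = int b mod int n"
    by (simp add: mod_eq_dvd_iff)
  then show ?thesis by (metis of_nat_eq_iff of_nat_mod)
qed

text \<open>Start and length stay visible as parameters, so that the end
  \<open>(p + d) mod n\<close>, the first position behind the arc, is available; the arguments on
  the cycle compare starts with ends.\<close>

definition arc :: "nat \<Rightarrow> nat \<Rightarrow> nat \<Rightarrow> nat set" where
  "arc n p d = (\<lambda>i. (p + i) mod n) ` {..<d}"

lemma arcI: "r = (p + i) mod n \<Longrightarrow> i < d \<Longrightarrow> r \<in> arc n p d"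
  by (auto simp: arc_def)

lemma arc_subset: "0 < n \<Longrightarrow> arc n p d \<subseteq> {..<n}"
  by (auto simp: arc_def)

lemma card_arc:
  assumes "d \<le> n"
  shows "card (arc n p d) = d"
proof -
  have "inj_on (\<lambda>i. (p + i) mod n) {..<d}"
  proof (rule linorder_inj_onI)
    fix i j assume ij: "i < j" "i \<in> {..<d}" "j \<in> {..<d}"
    show "(p + i) mod n \<noteq> (p + j) mod n"
    proof
      assume "(p + i) mod n = (p + j) mod n"
      then have "n dvd (p + j) - (p + i)"
        by (metis mod_eq_dvd_iff_nat ij(1) add_le_cancel_left less_imp_le)
      then have "n \<le> j - i" using ij by (auto dest: dvd_imp_le)
      then show False using ij assms by auto
    qed
  qed auto
  then show ?thesis by (simp add: arc_def card_image)
qed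

lemma arc_mono: "d \<le> e \<Longrightarrow> arc n p d \<subseteq> arc n p e"
  by (auto simp: arc_def)

lemma arc_shift_subset:
  assumes "Suc e \<le> d"
  shows "arc n (Suc p mod n) e \<subseteq> arc n p d"
proof
  fix r assume "r \<in> arc n (Suc p mod n) e"
  then obtain i where i: "i < e" "r = (Suc p mod n + i) mod n"
    by (auto simp: arc_def)
  then have "r = (p + Suc i) mod n" by (simp add: mod_simps)
  then show "r \<in> arc n p d" by (rule arcI) (use i assms in simp)
qed

text \<open>Cancelling \<open>d\<close> shows that \<open>p\<close> is \<open>q\<close> moved on by
  \<open>e - d\<close>, so the shorter arc is a final segment of the longer one.\<close>

lemma arc_same_end_subset:
  assumes "(p + d) mod n = (q + e) mod n" "d \<le> e"
  shows "arc n p d \<subseteq> arc n q e"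
proof
  have "(p + d) mod n = ((q + (e - d)) + d) mod n" using assms by simp
  then have pq: "p mod n = (q + (e - d)) mod n"
    by (rule mod_add_right_cancel_nat)
  fix r assume "r \<in> arc n p d"
  then obtain i where i: "i < d" "r = (p + i) mod n"
    by (auto simp: arc_def)
  then have "r = (q + (e - d + i)) mod n"
    using pq by (metis mod_add_left_eq add.assoc)
  then show "r \<in> arc n q e" by (rule arcI) (use i assms in simp)
qed

lemma arcs_adjacent_cover:
  assumes "p < n" "n \<le> d + e"
  shows "{..<n} \<subseteq> arc n p d \<union> arc n ((p + d) mod n) e"
proof
  fix r assume r: "r \<in> {..<n}"
  \<comment> \<open>The cyclic distance from \<open>p\<close> to \<open>r\<close> decides which of
    the two arcs contains \<open>r\<close>.\<close>
  define i where "i = (r + (n - p)) mod n"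
  have i: "i < n" "(p + i) mod n = r"
    using assms r by (auto simp: i_def mod_simps)
  show "r \<in> arc n p d \<union> arc n ((p + d) mod n) e"
  proof (cases "i < d")
    case True
    then show ?thesis using i by (auto simp: arc_def)
  next
    case False
    then have "r = ((p + d) + (i - d)) mod n" "i - d < e"
      using i assms by auto
    then have "r \<in> arc n ((p + d) mod n) e"
      by (intro arcI[of _ _ "i - d"]) (simp_all only: mod_add_left_eq)
    then show ?thesis by simp
  qed
qed

lemma arcs_adjacent_disjoint:
  assumes "d + e \<le> n"
  shows "arc n p d \<inter> arc n ((p + d) mod n) e = {}"
proof -
  have False if "i < d" "j < e" "(p + i) mod n = ((p + d) mod n + j) mod n" for i j
  proof -
    have "(p + i) mod n = (p + (d + j)) mod n" using that by (simp add: mod_simps add.assoc)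
    then have "n dvd (p + (d + j)) - (p + i)"
      using that mod_eq_dvd_iff_nat[of "p + i" "p + (d + j)" n] by auto
    then have "n \<le> d + j - i" using that by (auto dest: dvd_imp_le)
    then show False using that assms by auto
  qed
  then show ?thesis unfolding arc_def by blast
qed

text \<open>Each start carries at most one arc, hence the length function \<open>d\<close>. The
  antichain condition speaks of lengths because a common end and a common length fix the
  start.\<close>

locale arc_antichain =
  fixes n :: nat and X :: "nat set" and d :: "nat \<Rightarrow> nat"
  assumes starts: "X \<subseteq> {..<n}"
    and antichain: "\<And>p q. p \<in> X \<Longrightarrow> q \<in> X \<Longrightarrow> arc n p (d p) \<subseteq> arc n q (d q) \<Longrightarrow> d p = d q"
    and not_cover: "\<And>p q. p \<in> X \<Longrightarrow> q \<in> X \<Longrightarrow> arc n p (d p) \<union> arc n q (d q) \<noteq> {..<n}"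
begin

lemma finite_starts: "finite X"
  using starts by (rule finite_subset) simp

lemma adjacent_sum_less:
  assumes "p \<in> X" "(p + d p) mod n \<in> X"
  shows "d p + d ((p + d p) mod n) < n"
proof (rule ccontr)
  assume "\<not> ?thesis"
  moreover have "p < n" using assms starts by auto
  ultimately have "{..<n} \<subseteq> arc n p (d p) \<union> arc n ((p + d p) mod n) (d ((p + d p) mod n))"
    by (intro arcs_adjacent_cover) auto
  moreover have "arc n p (d p) \<union> arc n ((p + d p) mod n) (d ((p + d p) mod n)) \<subseteq> {..<n}"
    using arc_subset[of n] \<open>p < n\<close> by auto
  ultimately show False using not_cover[OF assms] by blast
qed

text \<open>Of two arcs with the same end one contains the other, so they are equally long and share
  their start.\<close>

lemma ends_inj: "inj_on (\<lambda>p. (p + d p) mod n) X"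
proof (rule inj_onI)
  fix p q assume pq: "p \<in> X" "q \<in> X" "(p + d p) mod n = (q + d q) mod n"
  have "d p = d q"
  proof (cases "d p \<le> d q")
    case True
    then show ?thesis using arc_same_end_subset[OF pq(3)] antichain pq by blast
  next
    case False
    then show ?thesis using arc_same_end_subset[OF pq(3)[symmetric]] antichain[of q p] pq by force
  qed
  then have "(p + d q) mod n = (q + d q) mod n" using pq by simp
  then have "p mod n = q mod n"
    by (rule mod_add_right_cancel_nat)
  moreover have "p < n" "q < n" using pq starts by auto
  ultimately show "p = q" by simp
qed

text \<open>By \<open>ends_inj\<close> the ends of the arcs from \<open>Y\<close> are as numerous as
  \<open>Y\<close>; they avoid \<open>Y\<close>, and both sets lie in \<open>{..<n}\<close>.\<close>

lemma twice_card_le: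
  assumes "Y \<subseteq> X" "\<And>p. p \<in> Y \<Longrightarrow> (p + d p) mod n \<notin> Y"
  shows "2 * card Y \<le> n"
proof -
  let ?Z = "(\<lambda>p. (p + d p) mod n) ` Y"
  have fin: "finite Y" using assms finite_starts by (auto intro: finite_subset)
  have "card ?Z = card Y" by (rule card_image) (use ends_inj assms in \<open>auto intro: inj_on_subset\<close>)
  moreover have "card (Y \<union> ?Z) = card Y + card ?Z"
    using assms fin by (intro card_Un_disjoint) auto
  moreover have "card (Y \<union> ?Z) \<le> card {..<n}"
    using assms starts by (intro card_mono) fastforce+
  ultimately show ?thesis by simp
qed

lemma twice_card_long_le: "2 * card {p \<in> X. n \<le> 2 * d p} \<le> n"
proof (rule twice_card_le)
  fix p assume p: "p \<in> {p \<in> X. n \<le> 2 * d p}"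
  show "(p + d p) mod n \<notin> {p \<in> X. n \<le> 2 * d p}"
    using adjacent_sum_less[of p] p by auto
qed auto

text \<open>An arc that starts where another ends is disjoint from it, because the two lengths add
  up to less than \<open>n\<close>.\<close>

lemma twice_card_intersecting_le:
  assumes "Y \<subseteq> X" "\<And>p q. p \<in> Y \<Longrightarrow> q \<in> Y \<Longrightarrow> arc n p (d p) \<inter> arc n q (d q) \<noteq> {}"
  shows "2 * card Y \<le> n"
proof (rule twice_card_le[OF assms(1)])
  fix p assume p: "p \<in> Y"
  show "(p + d p) mod n \<notin> Y"
  proof
    assume q: "(p + d p) mod n \<in> Y"
    then have "d p + d ((p + d p) mod n) < n"
      using adjacent_sum_less p assms(1) by blast
    then show False using arcs_adjacent_disjoint assms(2)[OF p q] by (metis less_imp_le)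
  qed
qed

text \<open>If all starting points occurred, lengths would be nondecreasing around the cycle, so the arc
  following a long arc would be long as well and complete it to the whole cycle.\<close>

lemma card_starts_less:
  assumes "p \<in> X" "n \<le> 2 * d p"
  shows "card X < n"
proof (rule ccontr)
  assume "\<not> card X < n"
  then have X: "X = {..<n}"
    using starts by (intro card_subset_eq) (auto dest: card_mono[rotated])
  have n: "0 < n" using assms X by auto
  \<comment> \<open>A shorter arc at the next start would lie inside the arc at
    \<open>q\<close>.\<close>
  have step: "d q \<le> d (Suc q mod n)" if "q \<in> X" for q
  proof (rule ccontr)
    assume "\<not> ?thesis"
    then have "Suc (d (Suc q mod n)) \<le> d q" by simp
    then show False using arc_shift_subset antichain[of "Suc q mod n" q] that X n by fastforce
  qed
  have "d p \<le> d ((p + i) mod n)" for i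
  proof (induction i)
    case 0
    then show ?case using assms X by simp
  next
    case (Suc i)
    have "d ((p + i) mod n) \<le> d (Suc ((p + i) mod n) mod n)"
      using step[of "(p + i) mod n"] X n by simp
    then show ?case using Suc by (simp add: mod_simps)
  qed
  then have "d p + d p \<le> d p + d ((p + d p) mod n)" by simp
  moreover have "d p + d ((p + d p) mod n) < n"
    using adjacent_sum_less assms X n by simp
  ultimately show False using assms by simp
qed

end

section \<open>Averaging over cyclic orders\<close>

lemma ex_permutes_image:
  assumes "finite U" "S \<subseteq> U" "T \<subseteq> U" "card S = card T"
  obtains \<tau> where "\<tau> permutes U" "\<tau> ` S = T"
proof -
  have fin: "finite S" "finite T" using assms finite_subset by auto
  obtain f where f: "bij_betw f S T"
    using finite_same_card_bij[OF fin assms(4)] by blast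
  have "card (U - S) = card (U - T)"
    using assms fin by (simp add: card_Diff_subset)
  then obtain g where g: "bij_betw g (U - S) (U - T)"
    using finite_same_card_bij[of "U - S" "U - T"] assms by auto
  define \<tau> where "\<tau> = (\<lambda>x. if x \<in> S then f x else if x \<in> U then g x else x)"
  have "bij_betw \<tau> S T \<longleftrightarrow> bij_betw f S T" by (rule bij_betw_cong) (simp add: \<tau>_def)
  then have "bij_betw \<tau> S T" using f by simp
  moreover have "bij_betw \<tau> (U - S) (U - T) \<longleftrightarrow> bij_betw g (U - S) (U - T)"
    by (rule bij_betw_cong) (simp add: \<tau>_def)
  ultimately have "bij_betw \<tau> (S \<union> (U - S)) (T \<union> (U - T))"
    using g by (intro bij_betw_combine) auto
  then have "bij_betw \<tau> U U" using assms by (simp add: Un_absorb1)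
  then have "\<tau> permutes U" by (rule bij_imp_permutes) (use assms in \<open>auto simp: \<tau>_def\<close>)
  moreover have "\<tau> ` S = T" using \<open>bij_betw \<tau> S T\<close> by (simp add: bij_betw_def)
  ultimately show ?thesis by (rule that)
qed

text \<open>Sorting the permutations by the image of \<open>S\<close> gives
  \<open>card U choose card D\<close> classes; composing with a permutation that takes one image to
  another shows that they are equally large.\<close>

lemma card_permutes_image:
  assumes "finite U" "S \<subseteq> U" "D \<subseteq> U" "card S = card D"
  shows "card {\<pi>. \<pi> permutes U \<and> \<pi> ` S = D} * (card U choose card D) = fact (card U)"
proof -
  let ?P = "\<lambda>D. {\<pi>. \<pi> permutes U \<and> \<pi> ` S = D}"
  let ?F = "{T. T \<subseteq> U \<and> card T = card D}"
  have finP: "finite (?P T)" for T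
    by (rule finite_subset[OF _ finite_permutations[OF assms(1)]]) auto
  have le: "card (?P T) \<le> card (?P T')"
    if T: "T \<subseteq> U" "T' \<subseteq> U" "card T = card T'" for T T'
  proof -
    obtain \<tau> where \<tau>: "\<tau> permutes U" "\<tau> ` T = T'"
      using ex_permutes_image[OF assms(1) T] by blast
    have "inj_on ((\<circ>) \<tau>) (?P T)"
      using permutes_inj[OF \<tau>(1)] by (auto simp: inj_on_def inj_def fun_eq_iff)
    moreover have "(\<circ>) \<tau> ` ?P T \<subseteq> ?P T'"
      using \<tau> permutes_compose by (auto simp: image_comp[symmetric])
    ultimately show ?thesis by (rule card_inj_on_le) (rule finP)
  qed
  have finF: "finite ?F" using assms by simp
  have "{\<pi>. \<pi> permutes U} = (\<Union>T\<in>?F. ?P T)"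
  proof -
    have "\<pi> ` S \<subseteq> U \<and> card (\<pi> ` S) = card D" if "\<pi> permutes U" for \<pi>
      using that assms permutes_image[OF that]
      by (metis card_image image_mono inj_on_subset permutes_inj subset_UNIV)
    then show ?thesis by auto
  qed
  then have "fact (card U) = card (\<Union>T\<in>?F. ?P T)"
    using card_permutations[OF refl assms(1)] by simp
  also have "\<dots> = (\<Sum>T\<in>?F. card (?P T))"
    using finF finP by (intro card_UN_disjoint) auto
  also have "\<dots> = (\<Sum>T\<in>?F. card (?P D))"
    using le assms by (intro sum.cong refl antisym) auto
  also have "\<dots> = card (?P D) * (card U choose card D)"
    using assms by (simp add: n_subsets)
  finally show ?thesis by simp
qed

text \<open>Double counting of cyclic orders, starts and members of \<open>F\<close>: at each start,
  a fraction \<open>1 / (n choose card D)\<close> of all permutations lays \<open>D\<close> out as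
  the arc of its size.\<close>

lemma cyclic_averaging:
  fixes c :: "nat set \<Rightarrow> real"
  assumes n: "0 < n" and F: "F \<subseteq> Pow {..<n}"
    and bound: "\<And>\<pi>. \<pi> permutes {..<n} \<Longrightarrow>
      (\<Sum>p<n. \<Sum>D | D \<in> F \<and> \<pi> ` arc n p (card D) = D. c D) \<le> K"
  shows "real n * (\<Sum>D\<in>F. c D / real (n choose card D)) \<le> K"
proof -
  let ?P = "{\<pi>. \<pi> permutes {..<n}}"
  have fin: "finite F" "finite ?P"
    using F finite_subset finite_permutations by auto
  have cnt: "real (card {\<pi>. \<pi> permutes {..<n} \<and> \<pi> ` arc n p (card D) = D}) =
      fact n / real (n choose card D)" if D: "D \<in> F" for p D
  proof -
    have sub: "D \<subseteq> {..<n}" using D F by auto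
    then have d: "card D \<le> n" using card_mono[OF _ sub] by simp
    have "card {\<pi>. \<pi> permutes {..<n} \<and> \<pi> ` arc n p (card D) = D} * (n choose card D) = fact n"
      using card_permutes_image[of "{..<n}" "arc n p (card D)" D] sub arc_subset[OF n] card_arc[OF d]
      by simp
    then have "real (card {\<pi>. \<pi> permutes {..<n} \<and> \<pi> ` arc n p (card D) = D}) * real (n choose card D)
        = fact n" by (metis of_nat_fact of_nat_mult)
    then show ?thesis using d by (simp add: field_simps)
  qed
  have "fact n * (real n * (\<Sum>D\<in>F. c D / real (n choose card D))) =
      (\<Sum>D\<in>F. \<Sum>p<n. c D * (fact n / real (n choose card D)))"
    by (simp add: sum_distrib_left algebra_simps)
  also have "\<dots> = (\<Sum>D\<in>F. \<Sum>p<n. \<Sum>\<pi>\<in>?P. if \<pi> ` arc n p (card D) = D then c D else 0)"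
  proof (intro sum.cong refl)
    fix D p assume "D \<in> F"
    have "(\<Sum>\<pi>\<in>?P. if \<pi> ` arc n p (card D) = D then c D else 0) =
        (\<Sum>\<pi> | \<pi> permutes {..<n} \<and> \<pi> ` arc n p (card D) = D. c D)"
      using fin by (simp add: sum.inter_filter[symmetric])
    then show "c D * (fact n / real (n choose card D)) =
        (\<Sum>\<pi>\<in>?P. if \<pi> ` arc n p (card D) = D then c D else 0)"
      using cnt[OF \<open>D \<in> F\<close>, of p] by simp
  qed
  also have "\<dots> = (\<Sum>\<pi>\<in>?P. \<Sum>p<n. \<Sum>D\<in>F. if \<pi> ` arc n p (card D) = D then c D else 0)"
    by (subst sum.swap, subst sum.swap[of _ F], rule sum.swap)
  also have "\<dots> \<le> (\<Sum>\<pi>\<in>?P. K)"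
    using bound fin by (intro sum_mono) (simp add: sum.inter_filter)
  also have "\<dots> = fact n * K"
    by (simp add: card_permutations[of _ n])
  finally show ?thesis by simp
qed

text \<open>For the complements the last clause says that any two sets meet, which is the setting of
  Milner's bound. Its instance \<open>D = E\<close> excludes the full set.\<close>

definition uncovering_antichain :: "nat \<Rightarrow> nat set set \<Rightarrow> bool" where
  "uncovering_antichain n F \<longleftrightarrow> F \<subseteq> Pow {..<n} \<and>
    (\<forall>D\<in>F. \<forall>E\<in>F. D \<subseteq> E \<longrightarrow> D = E) \<and> (\<forall>D\<in>F. \<forall>E\<in>F. D \<union> E \<noteq> {..<n})"

lemma uncovering_antichainD:
  assumes "uncovering_antichain n F"
  shows "F \<subseteq> Pow {..<n}"
    and "D \<in> F \<Longrightarrow> E \<in> F \<Longrightarrow> D \<subseteq> E \<Longrightarrow> D = E"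
    and "D \<in> F \<Longrightarrow> E \<in> F \<Longrightarrow> D \<union> E \<noteq> {..<n}"
  using assms by (auto simp: uncovering_antichain_def)

lemma uncovering_antichain_finite: "uncovering_antichain n F \<Longrightarrow> finite F"
  by (rule finite_subset[OF uncovering_antichainD(1)]) auto

text \<open>Arcs from one start are nested, so at most one member of the antichain \<open>F\<close>
  appears as an arc from there. A cyclic order thus yields arcs with distinct starts, and they
  inherit both conditions on \<open>F\<close> through \<open>\<pi>\<close>.\<close>

lemma cyclic_hits:
  assumes n: "0 < n" and F: "uncovering_antichain n F"
    and \<pi>: "\<pi> permutes {..<n}"
  obtains X d where "arc_antichain n X d"
    and "\<And>p. p \<in> X \<Longrightarrow> \<pi> ` arc n p (d p) \<in> F \<and> card (\<pi> ` arc n p (d p)) = d p"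
    and "\<And>c :: nat set \<Rightarrow> real. (\<Sum>p<n. \<Sum>D | D \<in> F \<and> \<pi> ` arc n p (card D) = D. c D) =
      (\<Sum>p\<in>X. c (\<pi> ` arc n p (d p)))"
proof -
  note anti = uncovering_antichainD(2)[OF F] and cover = uncovering_antichainD(3)[OF F]
  define H where "H = (\<lambda>p. {D. D \<in> F \<and> \<pi> ` arc n p (card D) = D})"
  define X where "X = {p. p < n \<and> H p \<noteq> {}}"
  \<comment> \<open>For a start in \<open>X\<close> the member of \<open>H p\<close> is unique, so
    the choice is forced; elsewhere the value is arbitrary.\<close>
  define d where "d = (\<lambda>p. card (SOME D. D \<in> H p))"
  have uniq: "D = E" if "D \<in> H p" "E \<in> H p" for p D E
  proof (cases "card D \<le> card E")
    case True
    then have "D \<subseteq> E" using that arc_mono[of "card D" "card E" n p] unfolding H_def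
      by (metis (mono_tags, lifting) image_mono mem_Collect_eq)
    then show ?thesis using anti that by (simp add: H_def)
  next
    case False
    then have "E \<subseteq> D" using that arc_mono[of "card E" "card D" n p] unfolding H_def
      by (metis (mono_tags, lifting) image_mono mem_Collect_eq nat_le_linear)
    then show ?thesis using anti[of E D] that by (simp add: H_def)
  qed
  have Hp: "H p = {\<pi> ` arc n p (d p)}" if "p \<in> X" for p
  proof -
    have ex: "(SOME D. D \<in> H p) \<in> H p" using that by (auto simp: X_def intro: someI)
    then have "\<pi> ` arc n p (d p) = (SOME D. D \<in> H p)" by (simp add: H_def d_def)
    then have "\<pi> ` arc n p (d p) \<in> H p" using ex by simp
    then show ?thesis using uniq by blast
  qed
  have hit: "\<pi> ` arc n p (d p) \<in> F \<and> card (\<pi> ` arc n p (d p)) = d p" if "p \<in> X" for p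
  proof -
    have "(SOME D. D \<in> H p) \<in> H p" using that by (auto simp: X_def intro: someI)
    then show ?thesis by (simp add: H_def d_def)
  qed
  have "arc_antichain n X d"
  proof
    show "X \<subseteq> {..<n}" by (auto simp: X_def)
  next
    fix p q assume "p \<in> X" "q \<in> X" "arc n p (d p) \<subseteq> arc n q (d q)"
    then show "d p = d q" using hit anti by (metis image_mono)
  next
    fix p q assume "p \<in> X" "q \<in> X"
    then show "arc n p (d p) \<union> arc n q (d q) \<noteq> {..<n}"
      using hit cover by (metis image_Un permutes_image[OF \<pi>])
  qed
  moreover have "(\<Sum>p<n. \<Sum>D | D \<in> F \<and> \<pi> ` arc n p (card D) = D. c D) =
      (\<Sum>p\<in>X. c (\<pi> ` arc n p (d p)))" for c :: "nat set \<Rightarrow> real"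
  proof -
    have "(\<Sum>p<n. sum c (H p)) = (\<Sum>p\<in>X. sum c (H p))"
      by (rule sum.mono_neutral_right) (auto simp: X_def)
    also have "\<dots> = (\<Sum>p\<in>X. c (\<pi> ` arc n p (d p)))"
      using Hp by (intro sum.cong) auto
    finally show ?thesis by (simp add: H_def)
  qed
  ultimately show ?thesis using hit that by blast
qed

section \<open>Antichains in which no two sets cover the ground set\<close>

lemma binomial_card_nonzero:
  assumes "uncovering_antichain n F" "D \<in> F"
  shows "real (n choose card D) \<noteq> 0"
  using uncovering_antichainD(1)[OF assms(1)] assms(2) card_mono[of "{..<n}" D] by auto

section \<open>Binomial coefficients near the middle\<close>

lemma binomial_le_central:
  assumes "2 * d < n"
  shows "n choose d \<le> n choose ((n - 1) div 2)"
  using assms by (intro binomial_mono) auto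

lemma binomial_Suc_mult: "Suc k * (n choose Suc k) = (n - k) * (n choose k)"
  by (simp only: binomial_absorption binomial_absorb_comp)

text \<open>The largest coefficient stands at \<open>n div 2\<close>. For odd \<open>n\<close> this
  is \<open>m\<close>; for \<open>n = 2 * m + 2\<close> it exceeds the coefficient at
  \<open>m\<close> by the factor \<open>(m + 2) / (m + 1)\<close>.\<close>

lemma binomial_le_above_central:
  assumes "1 \<le> n" "m = (n - 1) div 2"
  shows "real (n choose d) \<le> real (n choose m) * (1 + 1 / (real m + 1))"
proof -
  have "real (n choose (n div 2)) \<le> real (n choose m) * (1 + 1 / (real m + 1))"
  proof (cases "odd n")
    case True
    then have "n div 2 = m" using assms by (auto elim: oddE)
    then show ?thesis by (simp add: algebra_simps)
  next
    case False
    then have n: "n = 2 * m + 2" using assms by presburger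
    have "Suc m * (n choose Suc m) = (m + 2) * (n choose m)"
      using binomial_Suc_mult[of m n] n by simp
    then have "(real m + 1) * real (n choose Suc m) = (real m + 2) * real (n choose m)"
      by (metis (no_types, opaque_lifting) of_nat_Suc of_nat_add of_nat_mult of_nat_numeral add.commute)
    then show ?thesis using n by (simp add: field_simps)
  qed
  moreover have "n choose d \<le> n choose (n div 2)" by (rule binomial_maximum)
  ultimately show ?thesis by linarith
qed

text \<open>The coefficients increase up to \<open>l = m - 1\<close>, and the step from
  \<open>l\<close> to \<open>m\<close> multiplies by \<open>(n - l) / m\<close>, which is at least
  \<open>(m + 2) / m\<close> since \<open>n \<ge> 2 * m + 1\<close>.\<close>

lemma binomial_le_below_central:
  assumes "m = (n - 1) div 2" "d < m"
  shows "real (n choose d) \<le> real (n choose m) * (real m / (real m + 2))"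
proof -
  obtain l where l: "m = Suc l" using assms(2) by (metis less_imp_Suc_add)
  have "n choose d \<le> n choose l" using assms l by (intro binomial_mono) auto
  moreover have "(m + 2) * (n choose l) \<le> (n - l) * (n choose l)"
    using assms l by (intro mult_right_mono) auto
  then have "(m + 2) * (n choose l) \<le> m * (n choose m)"
    using binomial_Suc_mult[of l n] l by simp
  then have "(real m + 2) * real (n choose l) \<le> real m * real (n choose m)"
    by (metis of_nat_add of_nat_le_iff of_nat_mult of_nat_numeral)
  then have "real (n choose l) \<le> real (n choose m) * (real m / (real m + 2))"
    by (simp add: field_simps)
  ultimately show ?thesis by linarith
qed

section \<open>Milner's bound and two refinements\<close>

text \<open>A weighted form of Milner's bound. A cycle with a set of at least half the size carries at
  most \<open>n - 1\<close> sets, which pays for the slightly larger weights of the at most \<open>n / 2\<close> such sets.\<close>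

lemma weighted_milner_bound:
  fixes c :: "nat set \<Rightarrow> real"
  assumes n: "1 \<le> n" and m: "m = (n - 1) div 2" and F: "uncovering_antichain n F"
    and short: "\<And>D. D \<in> F \<Longrightarrow> 2 * card D < n \<Longrightarrow> c D \<le> M"
    and long: "\<And>D. D \<in> F \<Longrightarrow> n \<le> 2 * card D \<Longrightarrow> c D \<le> M * (1 + 1 / (real m + 1))"
    and M: "0 \<le> M"
  shows "(\<Sum>D\<in>F. c D / real (n choose card D)) \<le> M"
proof -
  have "real n * (\<Sum>D\<in>F. c D / real (n choose card D)) \<le> real n * M"
  proof (rule cyclic_averaging)
    fix \<pi> :: "nat \<Rightarrow> nat" assume \<pi>: "\<pi> permutes {..<n}"
    have "0 < n" using n by simp
    then obtain X d where X: "arc_antichain n X d"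
      and hit: "\<And>p. p \<in> X \<Longrightarrow> \<pi> ` arc n p (d p) \<in> F \<and> card (\<pi> ` arc n p (d p)) = d p"
      and eq: "(\<Sum>p<n. \<Sum>D | D \<in> F \<and> \<pi> ` arc n p (card D) = D. c D) =
        (\<Sum>p\<in>X. c (\<pi> ` arc n p (d p)))"
      by (rule cyclic_hits[OF _ F \<pi>]) blast
    interpret arc_antichain n X d by (rule X)
    let ?L = "{p \<in> X. n \<le> 2 * d p}"
    have "(\<Sum>p\<in>X. c (\<pi> ` arc n p (d p))) \<le>
        (\<Sum>p\<in>X. M + (if n \<le> 2 * d p then M / (real m + 1) else 0))"
    proof (rule sum_mono)
      fix p assume "p \<in> X"
      then show "c (\<pi> ` arc n p (d p)) \<le> M + (if n \<le> 2 * d p then M / (real m + 1) else 0)"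
        using hit[of p] short[of "\<pi> ` arc n p (d p)"] long[of "\<pi> ` arc n p (d p)"]
        by (auto simp: distrib_left)
    qed
    also have "\<dots> = M * real (card X) + real (card ?L) * (M / (real m + 1))"
      using finite_starts by (simp add: sum.distrib sum.inter_filter[symmetric])
    also have "\<dots> \<le> real n * M"
    proof (cases "?L = {}")
      case True
      have "card X \<le> n" using starts card_mono[of "{..<n}" X] by simp
      then have "M * real (card X) \<le> M * real n" using M by (intro mult_left_mono) auto
      then show ?thesis unfolding True by (simp add: mult.commute)
    next
      case False
      then have "card X < n" using card_starts_less by auto
      then have "M * (real (card X) + 1) \<le> M * real n" using M by (intro mult_left_mono) auto
      \<comment> \<open>Since \<open>n \<le> 2 * m + 2\<close>, there are at most
        \<open>m + 1\<close> surpluses of \<open>M / (m + 1)\<close>, and the \<open>M\<close> saved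
        by the missing start pays for them.\<close>
      moreover have "card ?L \<le> m + 1" using twice_card_long_le m by linarith
      then have "real (card ?L) * (M / (real m + 1)) \<le> (real m + 1) * (M / (real m + 1))"
        using M by (intro mult_right_mono) auto
      then have "real (card ?L) * (M / (real m + 1)) \<le> M" by simp
      ultimately show ?thesis by (simp add: algebra_simps)
    qed
    finally show "(\<Sum>p<n. \<Sum>D | D \<in> F \<and> \<pi> ` arc n p (card D) = D. c D) \<le> real n * M"
      using eq by simp
  qed (use n uncovering_antichainD(1)[OF F] in auto)
  then show ?thesis using n by simp
qed

text \<open>With the weights \<open>n choose card D\<close> every member of \<open>F\<close>
  contributes exactly 1 to the weighted sum.\<close>

lemma milner_bound:
  assumes n: "1 \<le> n" and F: "uncovering_antichain n F"
  shows "card F \<le> n choose ((n - 1) div 2)"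
proof -
  have "(\<Sum>D\<in>F. real (n choose card D) / real (n choose card D)) = (\<Sum>D\<in>F. 1)"
    by (intro sum.cong refl divide_self binomial_card_nonzero[OF F])
  moreover have "(\<Sum>D\<in>F. real (n choose card D) / real (n choose card D)) \<le>
      real (n choose ((n - 1) div 2))"
    by (rule weighted_milner_bound[OF n refl F])
      (use binomial_le_central binomial_le_above_central[OF n refl] in auto)
  ultimately show ?thesis by simp
qed

text \<open>The weight of \<open>A\<close> may be multiplied by \<open>M / (n choose s)\<close>,
  with \<open>M\<close> the central coefficient, and still not exceed \<open>M\<close>. Then
  \<open>A\<close> contributes \<open>M / (n choose s)\<close> and every other member 1.\<close>

lemma milner_bound_with_small_set:
  assumes n: "1 \<le> n" and F: "uncovering_antichain n F"
    and A: "A \<in> F" "card A \<le> s" and s: "2 * s < n"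
  shows "real (card F) \<le> (1 - 1 / real (n choose s)) * real (n choose ((n - 1) div 2)) + 1"
proof -
  define M where "M = real (n choose ((n - 1) div 2))"
  define c where "c = (\<lambda>D. if D = A then real (n choose card A) * M / real (n choose s)
    else real (n choose card D))"
  have fin: "finite F" using F by (rule uncovering_antichain_finite)
  have cA: "c A \<le> M"
  proof -
    have "n choose card A \<le> n choose s" using A s by (intro binomial_mono) auto
    then have "real (n choose card A) * M \<le> real (n choose s) * M"
      by (intro mult_right_mono) (auto simp: M_def)
    then show ?thesis using s by (simp add: c_def field_simps)
  qed
  have "(\<Sum>D\<in>F. c D / real (n choose card D)) \<le> M"
  proof (rule weighted_milner_bound[OF n refl F])
    fix D assume "D \<in> F" "2 * card D < n"
    then show "c D \<le> M"
      using cA binomial_le_central[of "card D" n] by (cases "D = A") (auto simp: c_def M_def)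
  next
    fix D assume "D \<in> F" "n \<le> 2 * card D"
    moreover have "2 * card A < n" using A s by simp
    ultimately show "c D \<le> M * (1 + 1 / (real ((n - 1) div 2) + 1))"
      using binomial_le_above_central[OF n refl, of "card D"] by (auto simp: c_def M_def)
  qed (auto simp: M_def)
  moreover have "(\<Sum>D\<in>F. c D / real (n choose card D)) =
      c A / real (n choose card A) + (\<Sum>D\<in>F - {A}. c D / real (n choose card D))"
    using fin A by (simp add: sum.remove)
  moreover have "c A / real (n choose card A) = M / real (n choose s)"
    using binomial_card_nonzero[OF F A(1)] by (simp add: c_def)
  moreover have "(\<Sum>D\<in>F - {A}. c D / real (n choose card D)) = (\<Sum>D\<in>F - {A}. 1)"
    using binomial_card_nonzero[OF F] by (intro sum.cong refl) (auto simp: c_def simp del: of_nat_eq_0_iff)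
  moreover have "real (card (F - {A})) = real (card F) - 1"
    using card_Suc_Diff1[OF fin A(1)] by simp
  ultimately have "M / real (n choose s) + (real (card F) - 1) \<le> M" by simp
  then show ?thesis by (simp add: M_def left_diff_distrib)
qed

lemma milner_bound_intersecting:
  assumes n: "1 \<le> n" and m: "m = (n - 1) div 2" and F: "uncovering_antichain n F"
    and inter: "\<And>D E. D \<in> F \<Longrightarrow> E \<in> F \<Longrightarrow> k \<le> card D \<Longrightarrow> k \<le> card E \<Longrightarrow> D \<inter> E \<noteq> {}"
    and k: "k \<le> m" and ev: "even n \<Longrightarrow> 2 \<le> m"
  shows "real (card F) \<le> (1 - 1 / real n) * real (n choose m)"
proof -
  define M where "M = real (n choose m)"
  have M: "0 \<le> M" by (simp add: M_def)
  have one: "(\<Sum>D\<in>F. real (n choose card D) / real (n choose card D)) = (\<Sum>D\<in>F. 1)"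
    by (intro sum.cong refl divide_self binomial_card_nonzero[OF F])
  have "real n * (\<Sum>D\<in>F. real (n choose card D) / real (n choose card D)) \<le> (real n - 1) * M"
  proof (rule cyclic_averaging)
    fix \<pi> :: "nat \<Rightarrow> nat" assume \<pi>: "\<pi> permutes {..<n}"
    have "0 < n" using n by simp
    then obtain X d where X: "arc_antichain n X d"
      and hit: "\<And>p. p \<in> X \<Longrightarrow> \<pi> ` arc n p (d p) \<in> F \<and> card (\<pi> ` arc n p (d p)) = d p"
      and eq: "(\<Sum>p<n. \<Sum>D | D \<in> F \<and> \<pi> ` arc n p (card D) = D. real (n choose card D)) =
        (\<Sum>p\<in>X. real (n choose card (\<pi> ` arc n p (d p))))"
      by (rule cyclic_hits[OF _ F \<pi>]) blast
    interpret arc_antichain n X d by (rule X)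
    define B where "B = {p \<in> X. k \<le> d p}"
    define S where "S = {p \<in> X. \<not> k \<le> d p}"
    define L where "L = {p \<in> X. n \<le> 2 * d p}"
    have fin: "finite B" "finite S" "finite L" using finite_starts by (auto simp: B_def S_def L_def)
    have XBS: "X = B \<union> S" "B \<inter> S = {}" by (auto simp: B_def S_def)
    have cX: "card X = card B + card S" using XBS fin card_Un_disjoint by blast
    have cXn: "card X \<le> n" using starts card_mono[of "{..<n}" X] by simp
    have cB: "2 * card B \<le> n"
    proof (rule twice_card_intersecting_le)
      fix p q assume "p \<in> B" "q \<in> B"
      then have "\<pi> ` arc n p (d p) \<inter> \<pi> ` arc n q (d q) \<noteq> {}"
        using hit by (intro inter) (auto simp: B_def)
      then show "arc n p (d p) \<inter> arc n q (d q) \<noteq> {}"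
        by (metis image_Int[OF permutes_inj[OF \<pi>]] image_is_empty)
    qed (auto simp: B_def)
    have sS: "(\<Sum>p\<in>S. real (n choose d p)) \<le> real (card S) * (M * (real m / (real m + 2)))"
      using binomial_le_below_central[OF m] k by (intro sum_bounded_above) (auto simp: S_def M_def)
    have split: "(\<Sum>p\<in>X. real (n choose d p)) = (\<Sum>p\<in>B. real (n choose d p)) + (\<Sum>p\<in>S. real (n choose d p))"
      unfolding XBS(1) using fin XBS by (intro sum.union_disjoint) auto
    \<comment> \<open>Here \<open>t\<close> bounds the weight of \<open>B\<close> in units of
      \<open>M\<close>. With the bound \<open>sS\<close> for \<open>S\<close>, the second premise is
      the goal divided by \<open>M\<close> and multiplied by \<open>m + 2\<close>.\<close>
    have goal: "(\<Sum>p\<in>X. real (n choose d p)) \<le> (real n - 1) * M"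
      if sB: "(\<Sum>p\<in>B. real (n choose d p)) \<le> t * M"
        and le: "t * (real m + 2) + real (card S) * real m \<le> (real n - 1) * (real m + 2)" for t
    proof -
      have "t + real (card S) * (real m / (real m + 2)) \<le> real n - 1"
        using le by (simp add: field_simps)
      then have "(t + real (card S) * (real m / (real m + 2))) * M \<le> (real n - 1) * M"
        using M by (rule mult_right_mono)
      then show ?thesis using sB sS split by (simp add: algebra_simps)
    qed
    have "(\<Sum>p\<in>X. real (n choose d p)) \<le> (real n - 1) * M"
    proof (cases "odd n")
      case True
      then have nm: "n = 2 * m + 1" using m by (auto elim: oddE)
      \<comment> \<open>For odd \<open>n\<close> no coefficient exceeds \<open>M\<close>, so
        counting arcs is enough.\<close>
      have "(\<Sum>p\<in>B. real (n choose d p)) \<le> real (card B) * M"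
      proof (rule sum_bounded_above)
        fix p
        have "n div 2 = m" using nm by simp
        then show "real (n choose d p) \<le> M" using binomial_maximum[of n "d p"] by (simp add: M_def)
      qed
      moreover have "real (card B) * (real m + 2) + real (card S) * real m \<le> (real n - 1) * (real m + 2)"
      proof -
        have "(card B + card S) * m \<le> (2 * m + 1) * m" using cX cXn nm by (intro mult_right_mono) auto
        moreover have "card B \<le> m" using cB nm by simp
        ultimately have "card B * (m + 2) + card S * m \<le> 2 * m * (m + 2)"
          by (simp add: algebra_simps)
        then have "real (card B * (m + 2) + card S * m) \<le> real (2 * m * (m + 2))" by linarith
        then show ?thesis using nm by (simp add: algebra_simps)
      qed
      ultimately show ?thesis by (rule goal)
    next
      case False
      then have nm: "n = 2 * m + 2" using m n by presburger
      have m2: "2 \<le> m" using ev False by simp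
      \<comment> \<open>For even \<open>n\<close> only sets of at least half the size can weigh more
        than \<open>M\<close>; as \<open>k \<le> m\<close>, their arcs all belong to
        \<open>B\<close>.\<close>
      have LB: "L = {p \<in> B. n \<le> 2 * d p}" using k nm by (auto simp: L_def B_def)
      have "(\<Sum>p\<in>B. real (n choose d p)) \<le>
          (\<Sum>p\<in>B. M + (if n \<le> 2 * d p then M / (real m + 1) else 0))"
      proof (rule sum_mono)
        fix p
        show "real (n choose d p) \<le> M + (if n \<le> 2 * d p then M / (real m + 1) else 0)"
          using binomial_le_central[of "d p" n] binomial_le_above_central[OF n m, of "d p"] m
          by (auto simp: M_def distrib_left)
      qed
      also have "\<dots> = (real (card B) + real (card L) / (real m + 1)) * M"
        using fin by (simp add: sum.distrib sum.inter_filter[symmetric] LB algebra_simps)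
      finally have sB: "(\<Sum>p\<in>B. real (n choose d p)) \<le> (real (card B) + real (card L) / (real m + 1)) * M" .
      have "card L \<le> m + 1" using twice_card_long_le nm by (simp add: L_def)
      then have L1: "real (card L) / (real m + 1) \<le> 1" by simp
      have B1: "card B \<le> m + 1" using cB nm by simp
      have "(real (card B) + real (card L) / (real m + 1)) * (real m + 2) + real (card S) * real m
          \<le> (real n - 1) * (real m + 2)"
      proof (cases "L = {}")
        case True
        have "(card B + card S) * m \<le> (2 * m + 2) * m" using cX cXn nm by (intro mult_right_mono) auto
        then have "card B * (m + 2) + card S * m \<le> (2 * m + 1) * (m + 2)"
          using B1 by (simp add: algebra_simps)
        then have "real (card B * (m + 2) + card S * m) \<le> real ((2 * m + 1) * (m + 2))" by linarith
        then show ?thesis using nm True by (simp add: algebra_simps)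
      next
        case False
        then have "card X < n" using card_starts_less by (auto simp: L_def)
        then have "(card B + card S) * m \<le> (2 * m + 1) * m" using cX nm by (intro mult_right_mono) auto
        \<comment> \<open>After cancellation this is \<open>4 * m + 4 \<le> 5 * m + 2\<close>, which
          is where \<open>m \<ge> 2\<close> enters.\<close>
        then have "card B * (m + 2) + card S * m + (m + 2) \<le> (2 * m + 1) * (m + 2)"
          using B1 m2 by (simp add: algebra_simps)
        then have "real (card B * (m + 2) + card S * m + (m + 2)) \<le> real ((2 * m + 1) * (m + 2))"
          by linarith
        moreover have "real (card L) / (real m + 1) * (real m + 2) \<le> 1 * (real m + 2)"
          using L1 by (intro mult_right_mono) auto
        ultimately show ?thesis using nm by (simp add: algebra_simps)
      qed
      with sB show ?thesis by (rule goal)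
    qed
    then show "(\<Sum>p<n. \<Sum>D | D \<in> F \<and> \<pi> ` arc n p (card D) = D. real (n choose card D)) \<le> (real n - 1) * M"
      unfolding eq using hit by simp
  qed (use n uncovering_antichainD(1)[OF F] in auto)
  then have "real n * real (card F) \<le> (real n - 1) * M" using one by simp
  then show ?thesis using n by (simp add: field_simps M_def)
qed

section \<open>Agreement sets of a frameproof code\<close>

text \<open>Positions are shifted down by one, so that agreement sets live in \<open>{..<n}\<close>,
  the residues modulo \<open>n\<close> that form the cycle.\<close>

definition agree :: "nat \<Rightarrow> (nat \<Rightarrow> nat) \<Rightarrow> (nat \<Rightarrow> nat) \<Rightarrow> nat set" where
  "agree n x y = {i. i < n \<and> x (Suc i) = y (Suc i)}"

text \<open>Otherwise \<open>z\<close> would agree with \<open>x\<close> wherever \<open>x\<close>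
  and \<open>y\<close> agree, and so be a further codeword in \<open>wdesc q n {x, y}\<close>. The
  case \<open>x = y\<close> is included; it is needed when an agreement set is paired with
  itself.\<close>

lemma frameproof_separating_position:
  assumes C: "wide_sense_frameproof q n 2 C" and "x \<in> C" "y \<in> C" "z \<in> C" "z \<noteq> x" "z \<noteq> y"
  obtains i where "i \<in> agree n x y" "z (Suc i) \<noteq> x (Suc i)"
proof -
  have sub: "C \<subseteq> words q n"
    and desc: "\<And>X. X \<subseteq> C \<Longrightarrow> X \<noteq> {} \<Longrightarrow> card X \<le> 2 \<Longrightarrow> wdesc q n X \<inter> C = X"
    using C by (simp_all add: wide_sense_frameproof_def)
  have "wdesc q n {x, y} \<inter> C = {x, y}"
    by (rule desc) (use assms in \<open>auto simp: card_insert_if\<close>)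
  then have "z \<notin> wdesc q n {x, y}" using assms(4-6) by auto
  moreover have "z \<in> words q n" using sub assms(4) by auto
  ultimately have "\<exists>j\<in>undetectable n {x, y}. \<exists>c\<in>{x, y}. z j \<noteq> c j"
    unfolding wdesc_def by blast
  then obtain j c where jc: "j \<in> undetectable n {x, y}" "c \<in> {x, y}" "z j \<noteq> c j" by blast
  have "j \<in> {1..n} \<and> (\<forall>c\<in>{x, y}. \<forall>c'\<in>{x, y}. c j = c' j)"
    using jc(1) unfolding undetectable_def by (rule CollectD)
  then have j: "j \<in> {1..n}" "x j = y j" by blast+
  then have "z j \<noteq> x j" using jc(2,3) by (metis insertE singletonD)
  moreover have "j - 1 < n" "Suc (j - 1) = j" using j(1) by auto
  ultimately have "j - 1 \<in> agree n x y" "z (Suc (j - 1)) \<noteq> x (Suc (j - 1))"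
    using j(2) by (simp_all add: agree_def)
  then show ?thesis by (rule that)
qed

text \<open>A position separating \<open>z\<close> from \<open>x\<close> and \<open>y\<close>
  belongs to the first agreement set but not to the second. Concluding \<open>y = z\<close>, and not
  just equality of the sets, also yields injectivity.\<close>

lemma agree_antichain:
  assumes C: "wide_sense_frameproof q n 2 C" and "x \<in> C"
    and "y \<in> C - {x}" "z \<in> C - {x}" "agree n x y \<subseteq> agree n x z"
  shows "y = z"
proof (rule ccontr)
  assume "y \<noteq> z"
  then obtain i where "i \<in> agree n x y" "z (Suc i) \<noteq> x (Suc i)"
    using frameproof_separating_position[OF C, of x y z] assms by blast
  then show False using assms(5) by (auto simp: agree_def)
qed

lemma agree_uncovering_antichain:
  assumes C: "wide_sense_frameproof q n 2 C" and x: "x \<in> C"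
  shows "uncovering_antichain n (agree n x ` (C - {x}))"
proof -
  have "agree n x y \<union> agree n x z \<noteq> {..<n}" if yz: "y \<in> C - {x}" "z \<in> C - {x}" for y z
  proof -
    \<comment> \<open>The roles change: \<open>x\<close> is now the word outside
      \<open>wdesc q n {y, z}\<close>. Where \<open>y\<close> and \<open>z\<close> agree and
      \<open>x\<close> differs from them, neither agreement set has the position.\<close>
    obtain i where "i \<in> agree n y z" "x (Suc i) \<noteq> y (Suc i)"
      by (rule frameproof_separating_position[OF C, of y z x]) (use x yz in auto)
    then have "i \<in> {..<n} - (agree n x y \<union> agree n x z)" by (auto simp: agree_def)
    then show ?thesis by blast
  qed
  moreover have "agree n x ` (C - {x}) \<subseteq> Pow {..<n}" by (auto simp: agree_def)
  ultimately show ?thesis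
    using agree_antichain[OF C x] unfolding uncovering_antichain_def by blast
qed

lemma card_agree_family:
  assumes C: "wide_sense_frameproof q n 2 C" and x: "x \<in> C"
  shows "card C = card (agree n x ` (C - {x})) + 1"
proof -
  have "inj_on (agree n x) (C - {x})"
    using agree_antichain[OF C x] by (intro inj_onI) simp
  then have "card (agree n x ` (C - {x})) = card (C - {x})" by (rule card_image)
  then show ?thesis using card_Suc_Diff1[OF finite_frameproof[OF C] x] by simp
qed

lemma frameproof_card_le_central:
  assumes "wide_sense_frameproof q n 2 C" "1 \<le> n"
  shows "card C \<le> (n choose ((n - 1) div 2)) + 1"
proof (cases "C = {}")
  case False
  then obtain x where x: "x \<in> C" by blast
  show ?thesis
    using milner_bound[OF assms(2) agree_uncovering_antichain[OF assms(1) x]]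
      card_agree_family[OF assms(1) x] by simp
qed simp

text \<open>Two large disjoint agreement sets \<open>agree n x y\<close> and \<open>agree n x z\<close> would force
  \<open>agree n y z\<close> into the small complement of their union.\<close>

lemma agree_sets_intersect:
  assumes large: "k \<le> card (agree n x y)" "k \<le> card (agree n x z)"
    and small: "n \<le> 2 * k + s" "s < card (agree n y z)"
  shows "agree n x y \<inter> agree n x z \<noteq> {}"
proof
  assume disj: "agree n x y \<inter> agree n x z = {}"
  have fin: "finite (agree n u v)" for u v by (simp add: agree_def)
  have "agree n y z \<inter> (agree n x y \<union> agree n x z) = {}"
    using disj by (auto simp: agree_def)
  then have "card (agree n y z \<union> (agree n x y \<union> agree n x z)) =
      card (agree n y z) + (card (agree n x y) + card (agree n x z))"
    using disj fin by (simp add: card_Un_disjoint)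
  moreover have "card (agree n y z \<union> (agree n x y \<union> agree n x z)) \<le> card {..<n}"
    by (intro card_mono) (auto simp: agree_def)
  ultimately show False using assms by simp
qed

text \<open>A pair with small agreement saves the fraction \<open>1 / (n choose s)\<close>, and
  otherwise \<open>1 / n\<close> is saved, which is no less. Of the summand 2, one unit is the
  codeword \<open>x\<close> itself and the other comes from
  \<open>milner_bound_with_small_set\<close>.\<close>

lemma frameproof_card_le:
  assumes C: "wide_sense_frameproof q n 2 C" and k: "k \<le> (n - 1) div 2"
    and ks: "n \<le> 2 * k + s" and s: "2 * s < n"
  shows "real (card C) \<le> (1 - 1 / real (n choose s)) * real (n choose ((n - 1) div 2)) + 2"
proof -
  define M where "M = real (n choose ((n - 1) div 2))"
  \<comment> \<open>The bound on \<open>k\<close> gives \<open>2 * k < n\<close>, so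
    \<open>ks\<close> forces \<open>s \<ge> 1\<close>; with \<open>2 * s < n\<close> this makes
    \<open>n choose s\<close> at least \<open>n choose 1\<close>.\<close>
  have n: "1 \<le> n" and s1: "1 \<le> s" using s k ks by auto
  have nN: "n \<le> n choose s"
    using binomial_mono[of 1 s n] s s1 by simp
  show ?thesis
  proof (cases "\<exists>x\<in>C. \<exists>y\<in>C - {x}. card (agree n x y) \<le> s")
    case True
    then obtain x y where xy: "x \<in> C" "y \<in> C - {x}" "card (agree n x y) \<le> s" by blast
    have "agree n x y \<in> agree n x ` (C - {x})" using xy by blast
    from milner_bound_with_small_set[OF n agree_uncovering_antichain[OF C xy(1)] this xy(3) s]
    show ?thesis using card_agree_family[OF C xy(1)] by simp
  next
    case False
    then have large: "s < card (agree n u v)" if "u \<in> C" "v \<in> C" "v \<noteq> u" for u v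
      using that by (metis DiffI not_le singletonD)
    show ?thesis
    proof (cases "C = {}")
      case True
      moreover have "0 \<le> (1 - 1 / real (n choose s)) * M"
        using nN n by (intro mult_nonneg_nonneg) (auto simp: M_def divide_le_eq_1)
      ultimately show ?thesis by (simp add: M_def)
    next
      case False
      then obtain x where x: "x \<in> C" by blast
      let ?F = "agree n x ` (C - {x})"
      have "real (card ?F) \<le> (1 - 1 / real n) * M"
        unfolding M_def
      proof (rule milner_bound_intersecting[OF n refl agree_uncovering_antichain[OF C x] _ k])
        fix D E assume DE: "D \<in> ?F" "E \<in> ?F" "k \<le> card D" "k \<le> card E"
        then obtain y z where yz: "y \<in> C - {x}" "D = agree n x y" "z \<in> C - {x}" "E = agree n x z"
          by blast
        show "D \<inter> E \<noteq> {}"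
        proof (cases "y = z")
          case True
          have "s < card (agree n x y)" using yz by (intro large x) auto
          then show ?thesis using yz True by auto
        next
          case False
          then have "s < card (agree n y z)" using yz by (intro large) auto
          with ks show ?thesis using DE(3,4) unfolding yz by (intro agree_sets_intersect)
        qed
      next
        assume "even n"
        then obtain h where "n = 2 * h" by (rule evenE)
        moreover from this have "(n - 1) div 2 = h - 1" by simp
        \<comment> \<open>With \<open>n = 2 * h\<close>, the bound \<open>k \<le> h - 1\<close>
          forces \<open>s \<ge> 2\<close>, and then \<open>2 * s < n\<close> gives
          \<open>h \<ge> 3\<close>.\<close>
        ultimately show "2 \<le> (n - 1) div 2" using s k ks by arith
      qed
      also have "\<dots> \<le> (1 - 1 / real (n choose s)) * M"
      proof (rule mult_right_mono)
        have "1 / real (n choose s) \<le> 1 / real n" using nN n by (intro frac_le) simp_all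
        then show "1 - 1 / real n \<le> 1 - 1 / real (n choose s)" by simp
      qed (simp add: M_def)
      finally show ?thesis using card_agree_family[OF C x] by (simp add: M_def)
    qed
  qed
qed

section \<open>Choice of parameters and the final bound\<close>

theorem theorem1p3:
  fixes q n :: nat and \<epsilon> :: real
  assumes "q \<ge> 2" and "n \<ge> 1" and "0 < \<epsilon>" and "\<epsilon> < 1 / 2"
  shows "real (max_frameproof q n 2) \<le>
    max (real (\<Sum>i \<in> {3 * \<lceil>(1 - \<epsilon>) / 2 * real n\<rceil> - int n - 3 .. \<lceil>(1 - \<epsilon>) / 2 * real n\<rceil> - 1}.
                 int_binomial n i) + 1)
        ((1 - 1 / real (int_binomial n \<lfloor>\<epsilon> * real n\<rfloor>)) *
           real (int_binomial n \<lfloor>(real n - 1) / 2\<rfloor>) + 2)"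
proof -
  have "max_frameproof q n 2 \<in> {card C | C. wide_sense_frameproof q n 2 C}"
    unfolding max_frameproof_def
    by (rule Max_in[OF finite_frameproof_sizes frameproof_sizes_nonempty])
  then obtain C where C: "wide_sense_frameproof q n 2 C" and cC: "max_frameproof q n 2 = card C"
    by blast
  define m where "m = (n - 1) div 2"
  have m: "n = 2 * m + 1 \<or> n = 2 * m + 2" using assms(2) unfolding m_def by presburger
  define s where "s = nat \<lfloor>\<epsilon> * real n\<rfloor>"
  have pos: "0 < \<epsilon> * real n" "2 * (\<epsilon> * real n) < real n" using assms by auto
  have s: "\<lfloor>\<epsilon> * real n\<rfloor> = int s" using pos by (simp add: s_def)
  have s_bounds: "real s \<le> \<epsilon> * real n" "\<epsilon> * real n < real s + 1" using s by linarith+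
  define t where "t = (1 - \<epsilon>) / 2 * real n"
  have t: "2 * t = real n - \<epsilon> * real n" by (simp add: t_def left_diff_distrib)
  define k where "k = nat \<lceil>t\<rceil>"
  have "0 < t" using t pos by linarith
  then have k: "\<lceil>t\<rceil> = int k" by (simp add: k_def)
  have k_bounds: "t \<le> real k" "real k < t + 1" using k by linarith+
  have k1: "1 \<le> k" using k_bounds(1) \<open>0 < t\<close> by linarith
  have k2: "2 * k < n + 2" using k_bounds t pos by linarith
  \<comment> \<open>The integer \<open>2 * k\<close> is at least \<open>n - \<epsilon> * n\<close>,
    which exceeds \<open>n - s - 1\<close>.\<close>
  have ks: "n \<le> 2 * k + s" using k_bounds t s_bounds by linarith
  have s2: "2 * s < n" using s_bounds pos by linarith
  have mfl: "\<lfloor>(real n - 1) / 2\<rfloor> = int m"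
    using m by (intro floor_unique) auto
  show ?thesis
  proof (cases "k \<le> m")
    case True
    then have "real (card C) \<le> (1 - 1 / real (n choose s)) * real (n choose m) + 2"
      unfolding m_def by (intro frameproof_card_le[OF C _ ks s2])
    then show ?thesis unfolding cC s mfl by (simp add: int_binomial_def)
  next
    case False
    \<comment> \<open>From \<open>k > m\<close> and \<open>2 * k < n + 2\<close> follows
      \<open>k = m + 1\<close>, so the last summand is the central coefficient. The range does
      contain its upper end, because \<open>3 * k - n - 3 \<le> k - 1\<close> amounts to
      \<open>2 * k \<le> n + 2\<close>.\<close>
    then have km: "int k - 1 = int m" using k2 m by auto
    have "int_binomial n (int k - 1) \<le> (\<Sum>i \<in> {3 * int k - int n - 3 .. int k - 1}. int_binomial n i)"
      using k2 by (intro member_le_sum) auto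
    moreover have "int_binomial n (int k - 1) = n choose m" unfolding km by (simp add: int_binomial_def)
    moreover have "card C \<le> (n choose m) + 1"
      unfolding m_def by (rule frameproof_card_le_central[OF C assms(2)])
    ultimately have "real (card C) \<le>
        real (\<Sum>i \<in> {3 * int k - int n - 3 .. int k - 1}. int_binomial n i) + 1" by linarith
    then show ?thesis unfolding cC t_def[symmetric] k by simp
  qed
qed

end
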